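(* Let $\Theta=\{\theta_0,\ldots,\theta_n\}\subset\mathbb{R}$ be a finite set of states, let $A=\{a_0,\ldots,a_k\}\subset\mathbb{R}$ with $a_0<a_1<\cdots<a_k$ be a finite set of actions, and let $u:A\times\Theta\to\mathbb{R}$ be a payoff function. Let $\widehat{\Delta}_n$ denote the set of all beliefs on $\Theta$. Suppose that for every $i\in\{0,\ldots,k\}$ there exists a belief $\boldsymbol{p}(i)\in\widehat{\Delta}_n$ such that $A^*(\boldsymbol{p}(i))=\{a_i\}$. If $A^*(\boldsymbol{p})$ is convex relative to $A$ for each $\boldsymbol{p}\in\widehat{\Delta}_n$, then the decision problem $\{A,u\}$ is quasi-concave (QCC).
   Context: A belief is a probability vector $\boldsymbol{p}=(p_0,\ldots,p_n)$ with $p_i\ge 0$ and $\sum_{i=0}^n p_i=1$; $\widehat{\Delta}_n$ is the set of all beliefs. For a belief $\boldsymbol{p}$ and an action $a$, the expected payoff is $u(a,\boldsymbol{p}):=\sum_{i=0}^n p_i u(a,\theta_i)$, and the set of optimal actions is $A^*(\boldsymbol{p}):=\operatorname{arg\,max}_{a\in A}u(a,\boldsymbol{p})$. A subset $B\subseteq A$ is convex relative to $A$ if, whenever $a<b<c$ with $a,c\in B$ and $b\in A$, also $b\in B$. The decision problem $\{A,u\}$ is quasi-concave (QCC) if for each $\boldsymbol{p}\in\widehat{\Delta}_n$ the function $a\mapsto u(a,\boldsymbol{p})$ is quasi-concave on $A$, i.e. $u(b,\boldsymbol{p})\ge\min\{u(a,\boldsymbol{p}),u(c,\boldsymbol{p})\}$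 for all $a<b<c$ in $A$. *)

theory Defs
  imports "HOL-Homology.Simplices"
begin

text \<open>
  The states are \<open>\<theta> 0, \<dots>, \<theta> n\<close>, and a belief \<open>p\<close> gives probability \<open>p i\<close> to \<open>\<theta> i\<close>.
  The library's \<open>standard_simplex n\<close> represents a vector \<open>(p 0, \<dots>, p n)\<close> by a function on
  \<open>nat\<close> that is 0 beyond \<open>n\<close>; its condition \<open>p i \<le> 1\<close> follows from nonnegativity and total
  mass 1.
\<close>

abbreviation beliefs :: "nat \<Rightarrow> (nat \<Rightarrow> real) set" where
  "beliefs n \<equiv> standard_simplex n"

text \<open>
  A payoff function on \<open>A \<times> \<Theta>\<close> is represented by a total function; below, only its values at
  actions in \<open>A\<close> and states in \<open>\<theta> ` {..n}\<close> matter.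
\<close>

definition expected_payoff ::
  "(real \<Rightarrow> real \<Rightarrow> real) \<Rightarrow> (nat \<Rightarrow> real) \<Rightarrow> nat \<Rightarrow> real \<Rightarrow> (nat \<Rightarrow> real) \<Rightarrow> real" where
  "expected_payoff u \<theta> n a p = (\<Sum>i\<le>n. p i * u a (\<theta> i))"

definition optimal_actions ::
  "real set \<Rightarrow> (real \<Rightarrow> real \<Rightarrow> real) \<Rightarrow> (nat \<Rightarrow> real) \<Rightarrow> nat \<Rightarrow> (nat \<Rightarrow> real) \<Rightarrow> real set" where
  "optimal_actions A u \<theta> n p =
     {a. is_arg_max (\<lambda>b. expected_payoff u \<theta> n b p) (\<lambda>b. b \<in> A) a}"

definition convex_relative_to :: "real set \<Rightarrow> real set \<Rightarrow> bool" where
  "convex_relative_to A B \<longleftrightarrow>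
     B \<subseteq> A \<and> (\<forall>a\<in>B. \<forall>c\<in>B. \<forall>b\<in>A. a < b \<and> b < c \<longrightarrow> b \<in> B)"

definition quasi_concave_on :: "real set \<Rightarrow> (real \<Rightarrow> real) \<Rightarrow> bool" where
  "quasi_concave_on A f \<longleftrightarrow>
     (\<forall>a\<in>A. \<forall>b\<in>A. \<forall>c\<in>A. a < b \<and> b < c \<longrightarrow> f b \<ge> min (f a) (f c))"

definition QCC ::
  "real set \<Rightarrow> (real \<Rightarrow> real \<Rightarrow> real) \<Rightarrow> (nat \<Rightarrow> real) \<Rightarrow> nat \<Rightarrow> bool" where
  "QCC A u \<theta> n \<longleftrightarrow>
     (\<forall>p\<in>beliefs n. quasi_concave_on A (\<lambda>a. expected_payoff u \<theta> n a p))"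

end

theory Submission
  imports Defs
begin

text \<open>
  Suppose \<open>u(b, p) < min {u(a, p), u(c, p)}\<close> with \<open>a < b < c\<close>. Compare the best payoff from the
  actions below \<open>b\<close> with the best payoff from those above \<open>b\<close>, and say the former is at least as
  large at \<open>p\<close>. Move along the segment from \<open>p\<close> to a belief \<open>q\<close> at which \<open>c\<close> is uniquely optimal.
  At both ends \<open>c\<close> is strictly better than \<open>b\<close>, hence on the whole segment by linearity. The
  two best payoffs agree at some point by the intermediate value theorem; there the set
  of optimal actions meets both sides of \<open>b\<close> but omits \<open>b\<close>, so it is not convex.
\<close>

text \<open>Affine dependence on the belief gives both continuity of payoffs along a segment and
  persistence of a strict preference that holds at its two ends.\<close>

lemma expected_payoff_convex_combination:
  "expected_payoff u \<theta> n a (\<lambda>i. (1 - t) * p i + t * q i) =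
     (1 - t) * expected_payoff u \<theta> n a p + t * expected_payoff u \<theta> n a q"
  by (simp add: expected_payoff_def sum.distrib sum_subtractf sum_distrib_left algebra_simps)

lemma continuous_on_Max_image:
  fixes f :: "'i \<Rightarrow> 'a::topological_space \<Rightarrow> 'b::linorder_topology"
  assumes "finite I" "I \<noteq> {}" "\<And>i. i \<in> I \<Longrightarrow> continuous_on S (f i)"
  shows "continuous_on S (\<lambda>x. Max ((\<lambda>i. f i x) ` I))"
  using assms
  by (induction I rule: finite_ne_induct) (auto intro!: continuous_on_max)

lemma mem_optimal_actions_iff:
  "x \<in> optimal_actions A u \<theta> n p \<longleftrightarrow>
     x \<in> A \<and> (\<forall>y\<in>A. expected_payoff u \<theta> n y p \<le> expected_payoff u \<theta> n x p)"
  by (auto simp: optimal_actions_def is_arg_max_linorder)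

text \<open>An action doing at least as well as \<open>c\<close> would itself be a maximiser,
  against uniqueness.\<close>

lemma uniquely_optimal_less:
  assumes "optimal_actions A u \<theta> n q = {c}" "y \<in> A" "y \<noteq> c"
  shows "expected_payoff u \<theta> n y q < expected_payoff u \<theta> n c q"
proof (rule ccontr)
  assume "\<not> ?thesis"
  moreover have "\<forall>z\<in>A. expected_payoff u \<theta> n z q \<le> expected_payoff u \<theta> n c q"
    using assms(1) mem_optimal_actions_iff[of c A u \<theta> n q] by simp
  ultimately have "y \<in> optimal_actions A u \<theta> n q"
    unfolding mem_optimal_actions_iff using assms(2) by force
  then show False
    using assms by simp
qed

text \<open>The order of the actions is kept out of the statement, so that the two sides of
  \<open>b\<close> can be exchanged: one lemma serves both outcomes of the comparison at
  \<open>p\<close>.\<close>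

lemma optimal_on_both_sides:
  fixes u \<theta> and n :: nat and b c :: real and p q :: "nat \<Rightarrow> real"
  defines "V \<equiv> \<lambda>S p. Max ((\<lambda>x. expected_payoff u \<theta> n x p) ` S)"
  assumes A: "A = insert b (L \<union> R)"
    and L: "finite L" "L \<noteq> {}" and R: "finite R" "c \<in> R"
    and disjoint: "b \<notin> R" "c \<notin> L"
    and p: "p \<in> beliefs n" and q: "q \<in> beliefs n"
    and less: "expected_payoff u \<theta> n b p < expected_payoff u \<theta> n c p"
    and le: "V R p \<le> V L p"
    and unique: "optimal_actions A u \<theta> n q = {c}"
  obtains r x y where "r \<in> beliefs n" "x \<in> L" "y \<in> R"
    "x \<in> optimal_actions A u \<theta> n r" "y \<in> optimal_actions A u \<theta> n r"
    "b \<notin> optimal_actions A u \<theta> n r"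
proof -
  let ?U = "expected_payoff u \<theta> n"
  define s where "s t = (\<lambda>i. (1 - t) * p i + t * q i)" for t :: real
  have "R \<noteq> {}"
    using R by auto
  have cont: "continuous_on {0..1} (\<lambda>t. V S (s t))" if "finite S" "S \<noteq> {}" for S
    unfolding V_def s_def expected_payoff_convex_combination
    using that by (intro continuous_on_Max_image continuous_intros)
  \<comment> \<open>Since \<open>c\<close> lies in \<open>R\<close> but not in \<open>L\<close>, the
    side \<open>R\<close> wins at \<open>q\<close>, whereas \<open>le\<close> says that
    \<open>L\<close> is at least as good at \<open>p\<close>. Hence the difference changes sign
    along the segment.\<close>
  have "V L q \<le> ?U c q"
    unfolding V_def using L A disjoint
    by (auto intro: less_imp_le uniquely_optimal_less[OF unique])
  also have "?U c q \<le> V R q"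
    unfolding V_def using R by (intro Max_ge) auto
  finally have "V L q - V R q \<le> 0"
    by simp
  moreover have "continuous_on {0..1} (\<lambda>t. V L (s t) - V R (s t))"
    using L R \<open>R \<noteq> {}\<close> by (intro continuous_on_diff cont)
  ultimately obtain t where t: "0 \<le> t" "t \<le> 1" and eq: "V L (s t) = V R (s t)"
    using IVT2'[of "\<lambda>t. V L (s t) - V R (s t)" 1 0 0] le by (auto simp: s_def)
  define r where "r = s t"
  have r: "r \<in> beliefs n"
    unfolding r_def s_def using t p q by (intro convex_standard_simplex)
  have "?U b q < ?U c q"
    using A R disjoint by (intro uniquely_optimal_less[OF unique]) auto
  \<comment> \<open>Both gaps are positive. For \<open>t = 0\<close> the first term is positive and
    the second vanishes; otherwise the second is positive and the first nonnegative.\<close>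
  then have "(1 - t) * (?U c p - ?U b p) + t * (?U c q - ?U b q) > 0"
    using t less by (cases "t = 0") (auto intro!: add_nonneg_pos)
  then have bc: "?U b r < ?U c r"
    unfolding r_def s_def expected_payoff_convex_combination by (simp add: algebra_simps)
  \<comment> \<open>At \<open>r\<close> the common value of the two sides is the maximum over all of
    \<open>A\<close>, because \<open>b\<close> is beaten by \<open>c\<close>. So a maximiser on
    either side is optimal in \<open>A\<close>.\<close>
  have bound: "?U z r \<le> V L r" if "z \<in> A" for z
  proof -
    have ge: "?U z r \<le> V L r" if "z \<in> L \<union> R" for z
    proof (cases "z \<in> L")
      case True
      then show ?thesis
        unfolding V_def using L by (intro Max_ge) auto
    next
      case False
      then have "?U z r \<le> V R r"
        unfolding V_def using R that by (intro Max_ge) auto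
      then show ?thesis
        using eq by (simp add: r_def)
    qed
    show ?thesis
      using that A ge[of z] ge[of c] R bc by auto
  qed
  have attained: "\<exists>x\<in>S. V S r = ?U x r" if "finite S" "S \<noteq> {}" for S
    using Max_in[of "(\<lambda>x. ?U x r) ` S"] that unfolding V_def by blast
  obtain x where x: "x \<in> L" "V L r = ?U x r"
    using attained L by blast
  obtain y where y: "y \<in> R" "V R r = ?U y r"
    using attained R \<open>R \<noteq> {}\<close> by blast
  show thesis
  proof
    show "x \<in> optimal_actions A u \<theta> n r" "y \<in> optimal_actions A u \<theta> n r"
      using bound x y A eq by (auto simp: mem_optimal_actions_iff r_def)
    show "b \<notin> optimal_actions A u \<theta> n r"
      using bc A R by (auto simp: mem_optimal_actions_iff not_le)
  qed (use r x y in auto)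
qed

theorem proposition1:
  fixes n k :: nat
    and \<theta> a :: "nat \<Rightarrow> real"
    and A :: "real set"
    and u :: "real \<Rightarrow> real \<Rightarrow> real"
  assumes states: "inj_on \<theta> {..n}"
    and actions_increasing: "strict_mono_on {..k} a"
    and actions: "A = a ` {..k}"
    and uniquely_optimal:
      "\<forall>i\<le>k. \<exists>p\<in>beliefs n. optimal_actions A u \<theta> n p = {a i}"
    and optimal_convex:
      "\<forall>p\<in>beliefs n. convex_relative_to A (optimal_actions A u \<theta> n p)"
  shows "QCC A u \<theta> n"
proof (rule ccontr)
  let ?U = "expected_payoff u \<theta> n" and ?O = "optimal_actions A u \<theta> n"
  let ?V = "\<lambda>S p. Max ((\<lambda>x. ?U x p) ` S)"
  assume "\<not> QCC A u \<theta> n"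
  then obtain p x b z where p: "p \<in> beliefs n" and A: "x \<in> A" "b \<in> A" "z \<in> A"
    and order: "x < b" "b < z" and worse: "?U b p < ?U x p" "?U b p < ?U z p"
    unfolding QCC_def quasi_concave_on_def by (auto simp: not_le)
  define L where "L = {y \<in> A. y < b}"
  define R where "R = {y \<in> A. b < y}"
  have split: "A = insert b (L \<union> R)" "A = insert b (R \<union> L)"
    using A by (auto simp: L_def R_def)
  have fin: "finite L" "finite R"
    by (auto simp: L_def R_def actions)
  have mem: "x \<in> L" "z \<in> R" "x \<notin> R" "z \<notin> L" "b \<notin> L" "b \<notin> R"
    using A order by (auto simp: L_def R_def)
  have unique: "\<exists>q\<in>beliefs n. ?O q = {y}" if "y \<in> A" for y
    using uniquely_optimal that by (auto simp: actions)
  have "\<exists>r\<in>beliefs n. \<exists>x'\<in>L. \<exists>z'\<in>R. x' \<in> ?O r \<and> z' \<in> ?O r \<and> b \<notin> ?O r"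
  proof (cases "?V R p \<le> ?V L p")
    case True
    obtain q where q: "q \<in> beliefs n" "?O q = {z}"
      using unique A by blast
    show ?thesis
      by (rule optimal_on_both_sides[OF split(1) fin(1) _ fin(2) _ _ _ p q(1) worse(2) True q(2)])
        (use mem in auto)
  next
    \<comment> \<open>The mirror image: \<open>L\<close> and \<open>R\<close> trade places, and the
      segment now leads to a belief where \<open>x\<close> is uniquely optimal.\<close>
    case False
    then have le: "?V L p \<le> ?V R p"
      by simp
    obtain q where q: "q \<in> beliefs n" "?O q = {x}"
      using unique A by blast
    show ?thesis
      by (rule optimal_on_both_sides[OF split(2) fin(2) _ fin(1) _ _ _ p q(1) worse(1) le q(2)])
        (use mem in auto)
  qed
  then obtain r x' z' where r: "r \<in> beliefs n" "x' \<in> L" "z' \<in> R"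
    "x' \<in> ?O r" "z' \<in> ?O r" "b \<notin> ?O r"
    by blast
  have "convex_relative_to A (?O r)"
    using optimal_convex r(1) by blast
  then have "b \<in> ?O r"
    using r A unfolding convex_relative_to_def L_def R_def by blast
  then show False
    using r by blast
qed

end
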